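(* Let $\mathcal{M}$ be a map of valence $q$ and let $j<\frac q2$ be a positive integer. Then $\mathcal{M}$ admits a symmetric $j$-corneration if and only if $j$ is odd and $\mathrm{Aut}(\mathcal{M})$ has a subgroup that acts half-reflexibly on $\mathcal{M}$ or on $\mathrm{P}(\mathcal{M})$.
   Context: Graphs are finite, may have parallel edges, and have no loops or semi-edges. A map $\mathcal{M}$ is an embedding of a graph (its skeleton) into a connected compact surface without boundary such that all components of the complement (the faces) are open disks. It has valence $q$ if every vertex is incident with $q$ edges. The flags of $\mathcal{M}$ are the triangles of its barycentric subdivision; for a flag $f$, $r_0f$, $r_1f$, $r_2f$ denote the flags sharing with $f$ its face-center-to-edge-midpoint side, face-center-to-vertex side, vertex-to-edge-midpoint side, respectively. A symmetry of $\mathcal{M}$ is an automorphism of the skeleton induced by a homeomorphism of the surface; the group $\mathrm{Aut}(\mathcal{M})$ of symmetries acts faithfully and semiregularly on flags, as the group of flag permutations preserving each of the three adjacency relations. A Petrie path of $\mathcal{M}$ is a closed walk such that for any three consecutive edges $e_1,e_2,e_3$, the edges $e_1,e_2$ lie in a face on one side of $e_2$ while $e_2,e_3$ lie in the face on the other side of $e_2$. The Petrie dual $\mathrm{P}(\mathcal{M})$ is the map with the same skeleton whose faces are obtained by removing the faces of $\mathcal{M}$ and spanning each Petrie path with a disk (in terms of flags: same flag set, with $r_0$ replaced by $r_0r_2$ and $r_1,r_2$ unchanged). $\mathrm{Aut}(\mathrm{P}(\mathcal{M}))=\mathrm{Aut}(\mathcal{M})$. A group $G$ of symmetries of a map $\mathcal{N}$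 acts half-reflexibly on $\mathcal{N}$ if $G$ is not transitive on the flags of $\mathcal{N}$ but for each face $F$ of $\mathcal{N}$ the stabilizer $G_F$ is transitive on the flags of $F$. A dart is an incident vertex-edge pair. A corner is a set $\{e_1,v,e_2\}$ with $e_1\neq e_2$ edges incident to the vertex $v$; it contains the darts $\{e_1,v\},\{e_2,v\}$. If the edges at $v$ are numbered consecutively around $v$ by $\mathbb{Z}_q$, a corner is a $j$-corner ($1\le j\le\frac q2$) if its two edges have labels differing by $\pm j$ modulo $q$. A corneration is a set $L$ of corners such that every dart is contained in exactly one corner of $L$; it is a $j$-corneration if all its corners are $j$-corners. $\mathrm{Aut}(L)$ is the group of symmetries of $\mathcal{M}$ preserving $L$. $L$ is symmetric if $\mathrm{Aut}(L)$ is transitive on the darts of $\mathcal{M}$. *)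

theory Defs
  imports "HOL-Algebra.Group" "HOL-Combinatorics.Permutations" "HOL-Number_Theory.Cong" Complex_Main
begin

text \<open>
  A map is given by its flags, i.e. the triangles of its barycentric subdivision, and the three
  flag adjacencies: \<open>r0\<close>, \<open>r1\<close>, \<open>r2\<close> send a flag to the flag sharing with it the side from face
  centre to edge midpoint, from face centre to vertex, from vertex to edge midpoint, respectively.
  The vertices, edges and faces are the sets of flags around them.
\<close>

record 'f flag_system =
  flags :: "'f set"
  r0 :: "'f \<Rightarrow> 'f"
  r1 :: "'f \<Rightarrow> 'f"
  r2 :: "'f \<Rightarrow> 'f"

definition orbit_of :: "('f \<Rightarrow> 'f) set \<Rightarrow> 'f \<Rightarrow> 'f set" where
  "orbit_of S f = {g. (f, g) \<in> {(x, s x) | x s. s \<in> S}\<^sup>*}"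

definition vertex_of :: "'f flag_system \<Rightarrow> 'f \<Rightarrow> 'f set" where
  "vertex_of M f = orbit_of {r1 M, r2 M} f"

definition edge_of :: "'f flag_system \<Rightarrow> 'f \<Rightarrow> 'f set" where
  "edge_of M f = orbit_of {r0 M, r2 M} f"

definition face_of :: "'f flag_system \<Rightarrow> 'f \<Rightarrow> 'f set" where
  "face_of M f = orbit_of {r0 M, r1 M} f"

definition vertices :: "'f flag_system \<Rightarrow> 'f set set" where
  "vertices M = vertex_of M ` flags M"

definition edges :: "'f flag_system \<Rightarrow> 'f set set" where
  "edges M = edge_of M ` flags M"

definition faces :: "'f flag_system \<Rightarrow> 'f set set" where
  "faces M = face_of M ` flags M"

text \<open>
  Gluing one triangle per flag along the adjacencies yields a closed surface exactly when the
  adjacencies are fixed-point-free involutions. That the four triangles around an edge midpoint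
  are distinct and close up (no semi-edges) is expressed by \<open>r0\<close> and \<open>r2\<close> commuting and having
  no common value.
\<close>

locale surface_map =
  fixes M :: "'f flag_system"
  assumes finite_flags: "finite (flags M)"
    and flags_nonempty: "flags M \<noteq> {}"
    and closed: "\<And>f. f \<in> flags M \<Longrightarrow> r0 M f \<in> flags M \<and> r1 M f \<in> flags M \<and> r2 M f \<in> flags M"
    and involutive: "\<And>f. f \<in> flags M \<Longrightarrow>
      r0 M (r0 M f) = f \<and> r1 M (r1 M f) = f \<and> r2 M (r2 M f) = f"
    and no_boundary: "\<And>f. f \<in> flags M \<Longrightarrow> r0 M f \<noteq> f \<and> r1 M f \<noteq> f \<and> r2 M f \<noteq> f"
    and r0_r2_commute: "\<And>f. f \<in> flags M \<Longrightarrow> r0 M (r2 M f) = r2 M (r0 M f)"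
    and no_semi_edge: "\<And>f. f \<in> flags M \<Longrightarrow> r0 M f \<noteq> r2 M f"
    and connected: "\<And>f g. \<lbrakk>f \<in> flags M; g \<in> flags M\<rbrakk> \<Longrightarrow> g \<in> orbit_of {r0 M, r1 M, r2 M} f"
    and no_loop: "\<And>f. f \<in> flags M \<Longrightarrow> vertex_of M (r0 M f) \<noteq> vertex_of M f"

definition incident_edges :: "'f flag_system \<Rightarrow> 'f set \<Rightarrow> 'f set set" where
  "incident_edges M v = {e \<in> edges M. v \<inter> e \<noteq> {}}"

definition has_valence :: "'f flag_system \<Rightarrow> nat \<Rightarrow> bool" where
  "has_valence M q \<longleftrightarrow> (\<forall>v \<in> vertices M. card (incident_edges M v) = q)"

definition petrie_dual :: "'f flag_system \<Rightarrow> 'f flag_system" where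
  "petrie_dual M = M\<lparr>r0 := r0 M \<circ> r2 M\<rparr>"

definition symmetries :: "'f flag_system \<Rightarrow> ('f \<Rightarrow> 'f) set" where
  "symmetries M = {g. g permutes flags M \<and>
     (\<forall>f \<in> flags M. g (r0 M f) = r0 M (g f) \<and> g (r1 M f) = r1 M (g f) \<and> g (r2 M f) = r2 M (g f))}"

definition Aut :: "'f flag_system \<Rightarrow> ('f \<Rightarrow> 'f) monoid" where
  "Aut M = \<lparr>carrier = symmetries M, monoid.mult = (\<circ>), one = id\<rparr>"

definition setwise_stabilizer :: "('f \<Rightarrow> 'f) set \<Rightarrow> 'f set \<Rightarrow> ('f \<Rightarrow> 'f) set" where
  "setwise_stabilizer G F = {g \<in> G. g ` F = F}"

definition transitive_on :: "('f \<Rightarrow> 'f) set \<Rightarrow> 'f set \<Rightarrow> bool" where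
  "transitive_on G X \<longleftrightarrow> (\<forall>x \<in> X. \<forall>y \<in> X. \<exists>g \<in> G. g x = y)"

definition acts_half_reflexibly :: "('f \<Rightarrow> 'f) set \<Rightarrow> 'f flag_system \<Rightarrow> bool" where
  "acts_half_reflexibly G N \<longleftrightarrow>
     subgroup G (Aut N) \<and>
     \<not> transitive_on G (flags N) \<and>
     (\<forall>F \<in> faces N. transitive_on (setwise_stabilizer G F) F)"

text \<open>
  A dart \<open>{v, e}\<close> is encoded as the pair \<open>(v, e)\<close>, and a corner \<open>{e1, v, e2}\<close> as the pair
  \<open>(v, {e1, e2})\<close>.
\<close>

definition darts :: "'f flag_system \<Rightarrow> ('f set \<times> 'f set) set" where
  "darts M = {(v, e). v \<in> vertices M \<and> e \<in> incident_edges M v}"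

definition corners :: "'f flag_system \<Rightarrow> ('f set \<times> 'f set set) set" where
  "corners M = {(v, {e1, e2}) | v e1 e2.
     v \<in> vertices M \<and> e1 \<in> incident_edges M v \<and> e2 \<in> incident_edges M v \<and> e1 \<noteq> e2}"

definition dart_in_corner :: "'f set \<times> 'f set \<Rightarrow> 'f set \<times> 'f set set \<Rightarrow> bool" where
  "dart_in_corner d c \<longleftrightarrow> fst d = fst c \<and> snd d \<in> snd c"

text \<open>
  The step \<open>r1 \<circ> r2\<close> passes from a flag to the next edge around its vertex, always in the same
  sense of rotation, so the edges at the vertex of \<open>f\<close> are numbered consecutively by
  \<open>numbered_edge M f 0\<close>, \<open>numbered_edge M f 1\<close>, and so on. Replacing \<open>f\<close> by another flag at the
  same vertex shifts or reverses the numbering.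
\<close>

definition numbered_edge :: "'f flag_system \<Rightarrow> 'f \<Rightarrow> nat \<Rightarrow> 'f set" where
  "numbered_edge M f i = edge_of M (((r1 M \<circ> r2 M) ^^ i) f)"

definition j_corner :: "'f flag_system \<Rightarrow> nat \<Rightarrow> 'f set \<times> 'f set set \<Rightarrow> bool" where
  "j_corner M j c \<longleftrightarrow> c \<in> corners M \<and>
     (let v = fst c; q = int (card (incident_edges M v)) in
      \<exists>f \<in> v. \<exists>a b. snd c = {numbered_edge M f a, numbered_edge M f b} \<and>
        ([int a - int b = int j] (mod q) \<or> [int a - int b = - int j] (mod q)))"

definition corneration :: "'f flag_system \<Rightarrow> ('f set \<times> 'f set set) set \<Rightarrow> bool" where
  "corneration M L \<longleftrightarrow> L \<subseteq> corners M \<and> (\<forall>d \<in> darts M. \<exists>!c. c \<in> L \<and> dart_in_corner d c)"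

definition j_corneration :: "'f flag_system \<Rightarrow> nat \<Rightarrow> ('f set \<times> 'f set set) set \<Rightarrow> bool" where
  "j_corneration M j L \<longleftrightarrow> corneration M L \<and> (\<forall>c \<in> L. j_corner M j c)"

definition act_dart :: "('f \<Rightarrow> 'f) \<Rightarrow> 'f set \<times> 'f set \<Rightarrow> 'f set \<times> 'f set" where
  "act_dart g d = (g ` fst d, g ` snd d)"

definition act_corner :: "('f \<Rightarrow> 'f) \<Rightarrow> 'f set \<times> 'f set set \<Rightarrow> 'f set \<times> 'f set set" where
  "act_corner g c = (g ` fst c, (`) g ` snd c)"

definition corneration_symmetries ::
    "'f flag_system \<Rightarrow> ('f set \<times> 'f set set) set \<Rightarrow> ('f \<Rightarrow> 'f) set" where
  "corneration_symmetries M L = {g \<in> symmetries M. act_corner g ` L = L}"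

definition symmetric_corneration :: "'f flag_system \<Rightarrow> ('f set \<times> 'f set set) set \<Rightarrow> bool" where
  "symmetric_corneration M L \<longleftrightarrow> corneration M L \<and>
     (\<forall>d \<in> darts M. \<forall>d' \<in> darts M. \<exists>g \<in> corneration_symmetries M L. act_dart g d = d')"

end

theory Submission
  imports Defs
begin

text \<open>
  Write \<open>s = r1 \<circ> r2\<close> for the rotation. Every \<open>j\<close>-corner joins the edges of some flags \<open>f\<close> and
  \<open>s\<^sup>j f\<close>, and \<open>f\<close> and \<open>r2 (s\<^sup>j f)\<close> give the same corner. Hence a \<open>j\<close>-corneration \<open>L\<close> amounts to
  a 2-colouring of the flags, a flag being black if its corner is in \<open>L\<close>, for which \<open>r2\<close> and
  \<open>s\<^sup>j\<close> swap the colours. If \<open>L\<close> is symmetric, the colour classes are the two flag orbits of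
  \<open>Aut(L)\<close>, so each of \<open>r0\<close>, \<open>r1\<close> either preserves or swaps the colours. As \<open>s\<^sup>j\<close> swaps them, \<open>r1\<close>
  preserves them and \<open>j\<close> is odd; the faces of \<open>M\<close> are monochromatic if \<open>r0\<close> preserves the colours,
  those of the Petrie dual if it swaps them. Conversely, a half-reflexible group has two flag
  orbits, swapped by \<open>r2\<close> and by \<open>s\<^sup>j\<close> for odd \<open>j\<close>, and the corners of the flags in one of
  them form a symmetric \<open>j\<close>-corneration.
\<close>

section \<open>Orbits under a set of flag operations\<close>

lemma orbit_of_refl: "f \<in> orbit_of S f"
  by (simp add: orbit_of_def)

lemma orbit_of_step:
  assumes "g \<in> orbit_of S f" "s \<in> S"
  shows "s g \<in> orbit_of S f"
proof -
  have "(g, s g) \<in> {(x, s x) | x s. s \<in> S}" using assms(2) by blast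
  then show ?thesis using assms(1) unfolding orbit_of_def by (auto intro: rtrancl_into_rtrancl)
qed

lemma orbit_of_induct [consumes 1, case_names base step]:
  assumes "g \<in> orbit_of S f" "P f" "\<And>x s. \<lbrakk>x \<in> orbit_of S f; P x; s \<in> S\<rbrakk> \<Longrightarrow> P (s x)"
  shows "P g"
proof -
  have "(f, g) \<in> {(x, s x) | x s. s \<in> S}\<^sup>*" using assms(1) by (simp add: orbit_of_def)
  then show ?thesis
    by (induction rule: rtrancl_induct) (use assms(2,3) in \<open>auto simp: orbit_of_def\<close>)
qed

lemma orbit_of_trans:
  assumes "h \<in> orbit_of S g" "g \<in> orbit_of S f"
  shows "h \<in> orbit_of S f"
  using assms by (simp add: orbit_of_def)

lemma orbit_of_closed:
  assumes "g \<in> orbit_of S f" "f \<in> X" "\<And>s x. \<lbrakk>s \<in> S; x \<in> X\<rbrakk> \<Longrightarrow> s x \<in> X"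
  shows "g \<in> X"
  using assms by (induction rule: orbit_of_induct) auto

text \<open>Every step of a path is undone by the same step, as the elements of \<open>S\<close> are
  involutions on \<open>X\<close>. The set \<open>X\<close> is carried along because the adjacencies
  of a map are constrained only on its flags.\<close>

lemma orbit_of_sym:
  assumes "g \<in> orbit_of S f" "f \<in> X" "\<And>s x. \<lbrakk>s \<in> S; x \<in> X\<rbrakk> \<Longrightarrow> s x \<in> X \<and> s (s x) = x"
  shows "f \<in> orbit_of S g"
  using assms(1)
proof (induction rule: orbit_of_induct)
  case base
  show ?case by (rule orbit_of_refl)
next
  case (step x s)
  have "x \<in> X" using orbit_of_closed[OF step.hyps(1) assms(2)] assms(3) by blast
  then have "x \<in> orbit_of S (s x)"
    using orbit_of_step[OF orbit_of_refl[of "s x" S] step.hyps(2)] assms(3)[OF step.hyps(2)] by simp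
  with step.IH show ?case by (rule orbit_of_trans)
qed

lemma orbit_of_eq:
  assumes "g \<in> orbit_of S f" "f \<in> X" "\<And>s x. \<lbrakk>s \<in> S; x \<in> X\<rbrakk> \<Longrightarrow> s x \<in> X \<and> s (s x) = x"
  shows "orbit_of S g = orbit_of S f"
  using orbit_of_trans[OF _ assms(1)] orbit_of_trans[OF _ orbit_of_sym[OF assms]] by blast

text \<open>A map that commutes with the steps carries paths from \<open>f\<close> to paths from
  \<open>g f\<close>, and every path from \<open>g f\<close> arises in this way.\<close>

lemma image_orbit_of:
  assumes "f \<in> X" "\<And>s x. \<lbrakk>s \<in> S; x \<in> X\<rbrakk> \<Longrightarrow> s x \<in> X \<and> g (s x) = s (g x)"
  shows "g ` orbit_of S f = orbit_of S (g f)"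
proof
  have "x \<in> X \<and> g x \<in> orbit_of S (g f)" if "x \<in> orbit_of S f" for x
    using that
    by (induction rule: orbit_of_induct) (use assms in \<open>auto simp: orbit_of_refl orbit_of_step\<close>)
  then show "g ` orbit_of S f \<subseteq> orbit_of S (g f)" by blast
  have "\<exists>x \<in> orbit_of S f. x \<in> X \<and> y = g x" if "y \<in> orbit_of S (g f)" for y
    using that
  proof (induction rule: orbit_of_induct)
    case base
    show ?case using assms(1) by (intro bexI[of _ f]) (simp_all add: orbit_of_refl)
  next
    case (step y s)
    from step.IH obtain x where x: "x \<in> orbit_of S f" "x \<in> X" "y = g x" by blast
    have "s x \<in> X \<and> g (s x) = s (g x)" by (rule assms(2)[OF step.hyps(2) x(2)])
    moreover have "s x \<in> orbit_of S f" by (rule orbit_of_step[OF x(1) step.hyps(2)])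
    ultimately show ?case using x(3) by (intro bexI[of _ "s x"]) simp_all
  qed
  then show "orbit_of S (g f) \<subseteq> g ` orbit_of S f" by blast
qed

text \<open>An element that commutes with \<open>S\<close> and sends one point of an orbit into that
  orbit maps the whole orbit onto itself. Hence elements of \<open>A\<close> that move points within
  a face already lie in its stabilizer.\<close>

lemma transitive_on_stabilizer_orbit_of:
  assumes "f \<in> X" "\<And>s x. \<lbrakk>s \<in> S; x \<in> X\<rbrakk> \<Longrightarrow> s x \<in> X \<and> s (s x) = x"
    and comm: "\<And>g s x. \<lbrakk>g \<in> A; s \<in> S; x \<in> X\<rbrakk> \<Longrightarrow> g (s x) = s (g x)"
    and trans: "\<And>x y. \<lbrakk>x \<in> orbit_of S f; y \<in> orbit_of S f\<rbrakk> \<Longrightarrow> \<exists>g \<in> A. g x = y"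
  shows "transitive_on (setwise_stabilizer A (orbit_of S f)) (orbit_of S f)"
  unfolding transitive_on_def
proof (intro ballI)
  fix x y assume xy: "x \<in> orbit_of S f" "y \<in> orbit_of S f"
  obtain g where g: "g \<in> A" "g x = y" using trans[OF xy] by blast
  have "x \<in> X" by (rule orbit_of_closed[OF xy(1) assms(1)]) (rule conjunct1[OF assms(2)])
  have "g ` orbit_of S x = orbit_of S (g x)"
    by (rule image_orbit_of[OF \<open>x \<in> X\<close>])
      (rule conjI[OF conjunct1[OF assms(2)] comm[OF g(1)]])
  then have "g ` orbit_of S f = orbit_of S f"
    using orbit_of_eq[OF xy(1) assms(1,2)] orbit_of_eq[OF xy(2) assms(1,2)] g(2) by simp
  with g show "\<exists>g \<in> setwise_stabilizer A (orbit_of S f). g x = y"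
    unfolding setwise_stabilizer_def by blast
qed

section \<open>Rotation around a vertex and the corner given by a flag\<close>

definition rot :: "'f flag_system \<Rightarrow> 'f \<Rightarrow> 'f" where
  "rot M = r1 M \<circ> r2 M"

lemma rot_apply: "rot M f = r1 M (r2 M f)"
  by (simp add: rot_def)

lemma numbered_edge_rot: "numbered_edge M f i = edge_of M ((rot M ^^ i) f)"
  by (simp add: numbered_edge_def rot_def)

text \<open>A flag picks a dart together with a sense of rotation around its vertex;
  \<open>j\<close> rotations in that sense lead to the second edge of the corner.\<close>

definition corner_at :: "'f flag_system \<Rightarrow> nat \<Rightarrow> 'f \<Rightarrow> 'f set \<times> 'f set set" where
  "corner_at M j f = (vertex_of M f, {edge_of M f, edge_of M ((rot M ^^ j) f)})"

context surface_map
begin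

lemma flag_simps [simp]:
  assumes "f \<in> flags M"
  shows "r0 M f \<in> flags M" "r1 M f \<in> flags M" "r2 M f \<in> flags M"
    "r0 M (r0 M f) = f" "r1 M (r1 M f) = f" "r2 M (r2 M f) = f"
  using closed[OF assms] involutive[OF assms] by auto

lemma rot_closed [simp]: "f \<in> flags M \<Longrightarrow> (rot M ^^ i) f \<in> flags M"
  by (induction i) (auto simp: rot_apply)

text \<open>In the dihedral group generated by \<open>r1\<close> and \<open>r2\<close>, conjugation
  by \<open>r2\<close> inverts the rotation; this form avoids negative powers.\<close>

lemma rot_reflect:
  "f \<in> flags M \<Longrightarrow> (rot M ^^ i) (r2 M ((rot M ^^ i) f)) = r2 M f"
proof (induction i arbitrary: f)
  case (Suc i)
  have "(rot M ^^ Suc i) (r2 M ((rot M ^^ Suc i) f))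
      = (rot M ^^ i) (rot M (r2 M (rot M ((rot M ^^ i) f))))"
    by (simp only: funpow_Suc_right o_apply funpow_swap1)
  also have "rot M (r2 M (rot M ((rot M ^^ i) f))) = r2 M ((rot M ^^ i) f)"
    using rot_closed[OF Suc.prems, of i] by (simp add: rot_apply)
  finally show ?case using Suc by simp
qed simp

lemma rot_inj:
  assumes "f \<in> flags M" "g \<in> flags M" "(rot M ^^ i) f = (rot M ^^ i) g"
  shows "f = g"
  using rot_reflect[OF assms(1), of i] rot_reflect[OF assms(2), of i] assms flag_simps(6) by metis

text \<open>Cancelling one rotation at each end lowers \<open>i\<close> by two, down to a flag fixed
  by \<open>r2\<close> (\<open>i = 0\<close>) or by \<open>r1\<close> (\<open>i = 1\<close>), which
  the absence of a boundary excludes. Thus the two senses of rotation at a vertex are never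
  confused.\<close>

lemma rot_neq_r2: "f \<in> flags M \<Longrightarrow> (rot M ^^ i) f \<noteq> r2 M f"
proof (induction i arbitrary: f rule: nat_less_induct)
  case (1 i)
  consider "i = 0" | "i = 1" | k where "i = Suc (Suc k)"
    by (metis One_nat_def not0_implies_Suc)
  then show ?case
  proof cases
    case 1
    with \<open>f \<in> flags M\<close> show ?thesis using no_boundary by fastforce
  next
    case 2
    with \<open>f \<in> flags M\<close> show ?thesis using no_boundary[of "r2 M f"] by (simp add: rot_apply)
  next
    case (3 k)
    let ?h = "r1 M (r2 M f)"
    have h: "?h \<in> flags M" using \<open>f \<in> flags M\<close> by simp
    have "(rot M ^^ i) f = rot M ((rot M ^^ Suc k) f)" by (simp add: 3)
    then have i: "(rot M ^^ i) f = rot M ((rot M ^^ k) ?h)"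
      by (simp only: funpow_Suc_right o_apply) (simp add: rot_apply)
    show ?thesis
    proof
      assume "(rot M ^^ i) f = r2 M f"
      then have "r1 M (r2 M ((rot M ^^ k) ?h)) = r2 M f" using i by (simp add: rot_apply)
      then have "(rot M ^^ k) ?h = r2 M (r1 M (r2 M f))"
        using flag_simps h rot_closed by metis
      moreover have "k < i" using 3 by simp
      ultimately show False using "1.IH" h by blast
    qed
  qed
qed

section \<open>Vertices, edges and darts as sets of flags\<close>

lemma vertex_in_flags: "\<lbrakk>g \<in> vertex_of M f; f \<in> flags M\<rbrakk> \<Longrightarrow> g \<in> flags M"
  unfolding vertex_of_def by (erule orbit_of_closed) auto

lemma vertex_of_eq: "\<lbrakk>g \<in> vertex_of M f; f \<in> flags M\<rbrakk> \<Longrightarrow> vertex_of M g = vertex_of M f"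
  unfolding vertex_of_def by (erule orbit_of_eq) auto

lemma self_in_vertex: "f \<in> vertex_of M f"
  by (simp add: vertex_of_def orbit_of_refl)

lemma vertex_of_step:
  "g \<in> vertex_of M f \<Longrightarrow> r1 M g \<in> vertex_of M f \<and> r2 M g \<in> vertex_of M f"
  unfolding vertex_of_def by (simp add: orbit_of_step)

lemma vertex_of_r2 [simp]: "f \<in> flags M \<Longrightarrow> vertex_of M (r2 M f) = vertex_of M f"
  by (rule vertex_of_eq) (auto simp: vertex_of_step self_in_vertex)

lemma rot_in_vertex: "g \<in> vertex_of M f \<Longrightarrow> (rot M ^^ i) g \<in> vertex_of M f"
  by (induction i) (auto simp: rot_apply vertex_of_step)

lemma vertex_of_rot [simp]:
  "f \<in> flags M \<Longrightarrow> vertex_of M ((rot M ^^ i) f) = vertex_of M f"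
  by (rule vertex_of_eq) (auto simp: rot_in_vertex self_in_vertex)

lemma edge_of_eq: "\<lbrakk>g \<in> edge_of M f; f \<in> flags M\<rbrakk> \<Longrightarrow> edge_of M g = edge_of M f"
  unfolding edge_of_def by (erule orbit_of_eq) auto

lemma edge_of_r2 [simp]: "f \<in> flags M \<Longrightarrow> edge_of M (r2 M f) = edge_of M f"
  by (rule edge_of_eq) (auto simp: edge_of_def orbit_of_refl orbit_of_step)

lemma edge_of_subset:
  assumes "f \<in> flags M"
  shows "edge_of M f \<subseteq> {f, r2 M f, r0 M f, r0 M (r2 M f)}"
proof
  fix x assume "x \<in> edge_of M f"
  then have "x \<in> orbit_of {r0 M, r2 M} f" by (simp add: edge_of_def)
  moreover have "r2 M (r0 M f) = r0 M (r2 M f)" "r2 M (r0 M (r2 M f)) = r0 M f"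
    using assms by (simp_all add: r0_r2_commute)
  ultimately show "x \<in> {f, r2 M f, r0 M f, r0 M (r2 M f)}"
    using assms by (elim orbit_of_closed) auto
qed

text \<open>Of the flags of an edge, those reached by \<open>r0\<close> lie at its other end, which
  is a different vertex since there are no loops. So a dart has two flags, swapped by
  \<open>r2\<close>.\<close>

lemma same_dart:
  assumes "f \<in> flags M" "g \<in> flags M" "vertex_of M f = vertex_of M g" "edge_of M f = edge_of M g"
  shows "g = f \<or> g = r2 M f"
proof -
  have "g \<in> edge_of M f" using assms(4) by (simp add: edge_of_def orbit_of_refl)
  then have "g \<in> {f, r2 M f, r0 M f, r0 M (r2 M f)}" using edge_of_subset assms(1) by blast
  moreover have "g \<noteq> r0 M f" using no_loop[of f] assms by auto
  moreover have "g \<noteq> r0 M (r2 M f)" using no_loop[of "r2 M f"] assms by auto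
  ultimately show ?thesis by blast
qed

lemma incident_edges_vertex_of:
  assumes "f \<in> flags M"
  shows "incident_edges M (vertex_of M f) = edge_of M ` vertex_of M f"
proof
  show "edge_of M ` vertex_of M f \<subseteq> incident_edges M (vertex_of M f)"
    using vertex_in_flags[OF _ assms]
    by (auto simp: incident_edges_def edges_def edge_of_def orbit_of_refl)
  show "incident_edges M (vertex_of M f) \<subseteq> edge_of M ` vertex_of M f"
  proof
    fix e assume "e \<in> incident_edges M (vertex_of M f)"
    then obtain g h where "g \<in> flags M" "e = edge_of M g" "h \<in> vertex_of M f" "h \<in> e"
      by (auto simp: incident_edges_def edges_def)
    then show "e \<in> edge_of M ` vertex_of M f" using edge_of_eq by blast
  qed
qed

lemma darts_eq: "darts M = (\<lambda>f. (vertex_of M f, edge_of M f)) ` flags M"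
proof
  show "darts M \<subseteq> (\<lambda>f. (vertex_of M f, edge_of M f)) ` flags M"
  proof clarify
    fix v e assume "(v, e) \<in> darts M"
    then obtain f where f: "f \<in> flags M" "v = vertex_of M f" "e \<in> incident_edges M v"
      by (auto simp: darts_def vertices_def)
    then obtain g where g: "g \<in> vertex_of M f" "e = edge_of M g"
      by (auto simp: incident_edges_vertex_of)
    show "(v, e) \<in> (\<lambda>f. (vertex_of M f, edge_of M f)) ` flags M"
    proof (rule image_eqI)
      show "(v, e) = (vertex_of M g, edge_of M g)" using f g vertex_of_eq by simp
      show "g \<in> flags M" using f g vertex_in_flags by blast
    qed
  qed
  show "(\<lambda>f. (vertex_of M f, edge_of M f)) ` flags M \<subseteq> darts M"
    by (auto simp: darts_def vertices_def incident_edges_vertex_of self_in_vertex)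
qed

section \<open>The valence as the period of the rotation\<close>

text \<open>If the two flags were the two different flags of a dart, then by
  \<open>rot_reflect\<close> some power of the rotation would act on \<open>f\<close> as
  \<open>r2\<close>, against \<open>rot_neq_r2\<close>.\<close>

lemma rot_edge_eq_iff:
  assumes "f \<in> flags M"
  shows "edge_of M ((rot M ^^ i) f) = edge_of M ((rot M ^^ k) f)
    \<longleftrightarrow> (rot M ^^ i) f = (rot M ^^ k) f" (is "?e \<longleftrightarrow> ?r")
proof
  assume "?e"
  then consider "?r" | "(rot M ^^ k) f = r2 M ((rot M ^^ i) f)"
    using same_dart[of "(rot M ^^ i) f" "(rot M ^^ k) f"] assms by auto
  then show "?r"
  proof cases
    case 2
    then have "(rot M ^^ i) ((rot M ^^ k) f) = r2 M f" using rot_reflect assms by simp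
    then have "(rot M ^^ (i + k)) f = r2 M f" by (simp add: funpow_add)
    with rot_neq_r2 assms show ?thesis by blast
  qed
qed simp

text \<open>The flags at a vertex form an orbit of a dihedral group, so they are the rotations of
  \<open>f\<close> and their mirror images; the period \<open>p\<close> bounds the
  exponents.\<close>

lemma vertex_of_eq_rot:
  assumes "f \<in> flags M" "g \<in> vertex_of M f" "0 < p" "(rot M ^^ p) f = f"
  shows "\<exists>i<p. g = (rot M ^^ i) f \<or> g = r2 M ((rot M ^^ i) f)"
proof -
  let ?R = "\<lambda>i. (rot M ^^ i) f"
  have per: "?R i = ?R (i mod p)" for i
    using funpow_mod_eq[OF assms(4)] by simp
  have fl: "?R i \<in> flags M" for i using assms(1) by simp
  \<comment> \<open>One rotation backwards. The exponent \<open>i + p - 1\<close> stands for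
    \<open>i - 1\<close>, which would go wrong at \<open>i = 0\<close> in the natural
    numbers.\<close>
  have pred: "r2 M (r1 M (?R i)) = ?R (i + p - 1)" for i
  proof -
    have "?R i = ?R (i + p)" by (simp add: funpow_add assms(4))
    also have "\<dots> = rot M (?R (i + p - 1))"
      using assms(3) by (metis Suc_pred' add_gr_0 funpow.simps(2) o_apply)
    finally show ?thesis by (simp add: rot_apply fl)
  qed
  have "\<exists>i. g = ?R i \<or> g = r2 M (?R i)"
    using assms(2) unfolding vertex_of_def
  proof (induction rule: orbit_of_induct)
    case base
    show ?case by (rule exI[of _ 0]) simp
  next
    case (step x s)
    then obtain i where i: "x = ?R i \<or> x = r2 M (?R i)" by blast
    from step.hyps(2) consider "s = r1 M" | "s = r2 M" by auto
    then show ?case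
    proof cases
      case 1
      have "r1 M (?R i) = r2 M (?R (i + p - 1))" using pred[of i] fl by (metis flag_simps(2,6))
      moreover have "r1 M (r2 M (?R i)) = ?R (Suc i)" by (simp add: rot_apply)
      ultimately show ?thesis using i 1 by metis
    next
      case 2
      then show ?thesis using i fl by auto
    qed
  qed
  then obtain i where "g = ?R i \<or> g = r2 M (?R i)" by blast
  then show ?thesis using per[of i] assms(3) by (metis mod_less_divisor)
qed

text \<open>Rotating \<open>f\<close> through its least period meets every edge at the vertex
  exactly once, as it runs through just one of the two flags of each dart.\<close>

lemma period_eq_valence:
  assumes "f \<in> flags M" "0 < p" "(rot M ^^ p) f = f" "\<And>i. \<lbrakk>0 < i; i < p\<rbrakk> \<Longrightarrow> (rot M ^^ i) f \<noteq> f"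
  shows "card (incident_edges M (vertex_of M f)) = p"
proof -
  let ?R = "\<lambda>i. (rot M ^^ i) f"
  have "inj_on (\<lambda>i. edge_of M (?R i)) {..<p}"
  proof (rule linorder_inj_onI)
    fix i k assume ik: "i < k" "k \<in> {..<p}"
    have "?R i \<noteq> ?R k"
    proof
      assume "?R i = ?R k"
      then have "(rot M ^^ i) f = (rot M ^^ i) ((rot M ^^ (k - i)) f)"
        using ik by (metis funpow_add le_add_diff_inverse less_imp_le_nat o_apply)
      then have "f = (rot M ^^ (k - i)) f" using rot_inj assms(1) rot_closed by blast
      then show False using assms(4)[of "k - i"] ik
        by (metis less_imp_diff_less lessThan_iff zero_less_diff)
    qed
    then show "edge_of M (?R i) \<noteq> edge_of M (?R k)" using rot_edge_eq_iff assms(1) by blast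
  qed auto
  moreover have "incident_edges M (vertex_of M f) = (\<lambda>i. edge_of M (?R i)) ` {..<p}"
  proof
    show "incident_edges M (vertex_of M f) \<subseteq> (\<lambda>i. edge_of M (?R i)) ` {..<p}"
    proof
      fix e assume "e \<in> incident_edges M (vertex_of M f)"
      then obtain g where "g \<in> vertex_of M f" "e = edge_of M g"
        using incident_edges_vertex_of assms(1) by auto
      with vertex_of_eq_rot[of f g p] assms(1-3) show "e \<in> (\<lambda>i. edge_of M (?R i)) ` {..<p}"
        by auto
    qed
    show "(\<lambda>i. edge_of M (?R i)) ` {..<p} \<subseteq> incident_edges M (vertex_of M f)"
      using incident_edges_vertex_of assms(1) rot_in_vertex self_in_vertex by auto
  qed
  ultimately show ?thesis by (simp add: card_image)
qed

lemma rot_period_exists: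
  assumes "f \<in> flags M"
  shows "\<exists>p>0. (rot M ^^ p) f = f"
proof -
  have "range (\<lambda>i. (rot M ^^ i) f) \<subseteq> flags M" using assms by auto
  then have "\<not> inj (\<lambda>i. (rot M ^^ i) f)"
    using finite_flags finite_subset infinite_iff_countable_subset by blast
  then obtain i k where "i < k" "(rot M ^^ i) f = (rot M ^^ k) f"
    by (metis linorder_injI)
  then have "(rot M ^^ i) f = (rot M ^^ i) ((rot M ^^ (k - i)) f)"
    by (metis funpow_add le_add_diff_inverse less_imp_le_nat o_apply)
  then have "f = (rot M ^^ (k - i)) f" using rot_inj assms rot_closed by blast
  with \<open>i < k\<close> show ?thesis by (metis zero_less_diff)
qed

text \<open>This ties the valence, defined by counting edges, to the rotation: \<open>q\<close> is
  the least period at every flag.\<close>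

lemma valence_period:
  assumes "has_valence M q" "f \<in> flags M"
  shows "0 < q" "(rot M ^^ q) f = f" "\<lbrakk>0 < i; i < q\<rbrakk> \<Longrightarrow> (rot M ^^ i) f \<noteq> f"
proof -
  define p where "p = (LEAST p. 0 < p \<and> (rot M ^^ p) f = f)"
  have p: "0 < p \<and> (rot M ^^ p) f = f"
    unfolding p_def by (rule LeastI_ex) (use rot_period_exists assms(2) in auto)
  have least: "(rot M ^^ i) f \<noteq> f" if "0 < i" "i < p" for i
    using not_less_Least[of i "\<lambda>p. 0 < p \<and> (rot M ^^ p) f = f"] that unfolding p_def by blast
  have "q = p"
    using period_eq_valence[of f p] p least assms by (auto simp: has_valence_def vertices_def)
  with p least show "0 < q" "(rot M ^^ q) f = f"
    "\<lbrakk>0 < i; i < q\<rbrakk> \<Longrightarrow> (rot M ^^ i) f \<noteq> f" by auto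
qed

lemma edge_rot_neq:
  assumes "has_valence M q" "f \<in> flags M" "0 < i" "i < q"
  shows "edge_of M ((rot M ^^ i) f) \<noteq> edge_of M f"
  using rot_edge_eq_iff[of f i 0] valence_period(3)[of q f i] assms by simp

section \<open>Corners of flags and \<open>j\<close>-corners\<close>

text \<open>The same corner is read from its other edge in the opposite sense of rotation:
  \<open>j\<close> steps lead back to the first edge.\<close>

lemma corner_at_reflect:
  assumes "f \<in> flags M"
  shows "corner_at M j (r2 M ((rot M ^^ j) f)) = corner_at M j f"
  using assms by (auto simp: corner_at_def rot_reflect)

lemma j_corner_corner_at:
  assumes "has_valence M q" "0 < j" "j < q" "f \<in> flags M"
  shows "j_corner M j (corner_at M j f)"
proof -
  have "corner_at M j f \<in> corners M"
  proof -
    have "edge_of M f \<noteq> edge_of M ((rot M ^^ j) f)"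
      using edge_rot_neq[of q f j] assms by metis
    moreover have "vertex_of M f \<in> vertices M" using assms(4) by (simp add: vertices_def)
    moreover have "edge_of M f \<in> incident_edges M (vertex_of M f)"
      "edge_of M ((rot M ^^ j) f) \<in> incident_edges M (vertex_of M f)"
      using assms(4) by (auto simp: incident_edges_vertex_of rot_in_vertex self_in_vertex)
    ultimately show ?thesis unfolding corners_def corner_at_def by blast
  qed
  moreover have "snd (corner_at M j f) = {numbered_edge M f 0, numbered_edge M f j}"
    by (simp add: corner_at_def numbered_edge_rot)
  moreover have "f \<in> fst (corner_at M j f)" by (simp add: corner_at_def self_in_vertex)
  moreover have "[int 0 - int j = - int j] (mod n)" for n by simp
  ultimately show ?thesis unfolding j_corner_def Let_def by blast
qed

text \<open>Swapping the two edges exchanges the two signs in the definition of a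
  \<open>j\<close>-corner, so with one of the two edges as the start the rotation by
  \<open>j\<close> reaches the other.\<close>

lemma j_corner_cases:
  assumes "has_valence M q" "j_corner M j c"
  obtains h where "h \<in> flags M" "c = corner_at M j h"
proof -
  have "fst c \<in> vertices M" using assms(2) by (auto simp: j_corner_def corners_def)
  then obtain g where g: "g \<in> flags M" "fst c = vertex_of M g" by (auto simp: vertices_def)
  have q: "card (incident_edges M (fst c)) = q"
    using assms(1) \<open>fst c \<in> vertices M\<close> by (simp add: has_valence_def)
  from assms(2) obtain f a b where f: "f \<in> fst c"
    and c: "snd c = {numbered_edge M f a, numbered_edge M f b}"
    and ab: "[int a - int b = int j] (mod (int q)) \<or> [int a - int b = - int j] (mod (int q))"
    unfolding j_corner_def Let_def q by blast
  have fl: "f \<in> flags M" using vertex_in_flags f g by auto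
  have v: "fst c = vertex_of M f" using vertex_of_eq f g by auto
  \<comment> \<open>The rotation has period \<open>q\<close> at \<open>f\<close>, so a congruence of
    labels modulo \<open>q\<close> becomes an equality of flags.\<close>
  have step: "(rot M ^^ k) f = (rot M ^^ j) ((rot M ^^ l) f)"
    if "[int k - int l = int j] (mod (int q))" for k l
  proof -
    have "[int k - int l + int l = int j + int l] (mod (int q))"
      using that by (rule cong_add) simp
    then have "[k = j + l] (mod q)" by (simp flip: cong_int_iff)
    then have "k mod q = (j + l) mod q" by (simp add: cong_def)
    then have "(rot M ^^ k) f = (rot M ^^ (j + l)) f"
      using funpow_mod_eq[OF valence_period(2)[OF assms(1) fl]] by metis
    then show ?thesis by (simp add: funpow_add)
  qed
  from ab show ?thesis
  proof
    assume "[int a - int b = int j] (mod (int q))"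
    then have "c = corner_at M j ((rot M ^^ b) f)"
      using step c v fl by (auto simp: corner_at_def numbered_edge_rot prod_eq_iff)
    then show ?thesis using that[OF rot_closed[OF fl]] by blast
  next
    assume "[int a - int b = - int j] (mod (int q))"
    then have "[- (int a - int b) = - (- int j)] (mod (int q))" by (simp only: cong_minus_minus_iff)
    then have "[int b - int a = int j] (mod (int q))" by simp
    then have "c = corner_at M j ((rot M ^^ a) f)"
      using step c v fl by (auto simp: corner_at_def numbered_edge_rot prod_eq_iff)
    then show ?thesis using that[OF rot_closed[OF fl]] by blast
  qed
qed

section \<open>Symmetries and their action\<close>

lemma symmetry_simps:
  assumes "g \<in> symmetries M" "f \<in> flags M"
  shows "g f \<in> flags M" "g (r0 M f) = r0 M (g f)" "g (r1 M f) = r1 M (g f)"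
    "g (r2 M f) = r2 M (g f)"
  using assms by (auto simp: symmetries_def permutes_in_image)

lemma symmetry_rot:
  assumes "g \<in> symmetries M" "f \<in> flags M"
  shows "g ((rot M ^^ i) f) = (rot M ^^ i) (g f)"
proof (induction i)
  case (Suc i)
  have "g ((rot M ^^ Suc i) f) = rot M (g ((rot M ^^ i) f))"
    using assms by (simp add: rot_apply symmetry_simps)
  then show ?case using Suc by simp
qed simp

lemma symmetry_vertex_of:
  "\<lbrakk>g \<in> symmetries M; f \<in> flags M\<rbrakk> \<Longrightarrow> g ` vertex_of M f = vertex_of M (g f)"
  unfolding vertex_of_def by (rule image_orbit_of) (auto simp: symmetry_simps)

lemma symmetry_edge_of:
  "\<lbrakk>g \<in> symmetries M; f \<in> flags M\<rbrakk> \<Longrightarrow> g ` edge_of M f = edge_of M (g f)"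
  unfolding edge_of_def by (rule image_orbit_of) (auto simp: symmetry_simps)

lemma act_corner_corner_at:
  "\<lbrakk>g \<in> symmetries M; f \<in> flags M\<rbrakk> \<Longrightarrow> act_corner g (corner_at M j f) = corner_at M j (g f)"
  by (simp add: act_corner_def corner_at_def symmetry_vertex_of symmetry_edge_of symmetry_rot)

lemma symmetries_comp: "\<lbrakk>g \<in> symmetries M; h \<in> symmetries M\<rbrakk> \<Longrightarrow> g \<circ> h \<in> symmetries M"
  by (auto simp: symmetries_def permutes_compose permutes_in_image)

lemma symmetries_inv:
  assumes "g \<in> symmetries M"
  shows "inv_into UNIV g \<in> symmetries M"
proof -
  have p: "g permutes flags M" using assms by (simp add: symmetries_def)
  have "inv_into UNIV g (r f) = r (inv_into UNIV g f)"
    if "f \<in> flags M" "\<And>x. x \<in> flags M \<Longrightarrow> g (r x) = r (g x)" for r f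
  proof -
    have "inv_into UNIV g f \<in> flags M" using p that(1) by (simp add: permutes_inv permutes_in_image)
    then have "g (r (inv_into UNIV g f)) = r f" using that p by (simp add: permutes_inverses)
    then show ?thesis using p by (metis permutes_inverses(2))
  qed
  then show ?thesis using assms p by (simp add: symmetries_def permutes_inv)
qed

lemma symmetries_inv_o: "g \<in> symmetries M \<Longrightarrow> inv_into UNIV g \<circ> g = id"
  by (auto simp: symmetries_def intro: permutes_inv_o(2))

lemma group_Aut: "group (Aut M)"
proof (rule groupI)
  fix g assume "g \<in> carrier (Aut M)"
  then show "\<exists>h \<in> carrier (Aut M). h \<otimes>\<^bsub>Aut M\<^esub> g = \<one>\<^bsub>Aut M\<^esub>"
    by (intro bexI[of _ "inv_into UNIV g"])
      (auto simp: Aut_def symmetries_inv symmetries_inv_o)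
qed (auto simp: Aut_def symmetries_comp comp_assoc, auto simp: symmetries_def permutes_id)

lemma m_inv_Aut: "g \<in> symmetries M \<Longrightarrow> m_inv (Aut M) g = inv_into UNIV g"
  by (rule group.inv_equality[OF group_Aut])
    (auto simp: Aut_def symmetries_inv symmetries_inv_o)

lemma subgroup_symmetries:
  assumes "subgroup G (Aut M)"
  shows "G \<subseteq> symmetries M" "id \<in> G" "\<lbrakk>g \<in> G; h \<in> G\<rbrakk> \<Longrightarrow> g \<circ> h \<in> G"
    "g \<in> G \<Longrightarrow> inv_into UNIV g \<in> G"
proof -
  show *: "G \<subseteq> symmetries M" using subgroup.subset[OF assms] by (simp add: Aut_def)
  show "id \<in> G" using subgroup.one_closed[OF assms] by (simp add: Aut_def)
  show "\<lbrakk>g \<in> G; h \<in> G\<rbrakk> \<Longrightarrow> g \<circ> h \<in> G" using subgroup.m_closed[OF assms] by (simp add: Aut_def)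
  show "g \<in> G \<Longrightarrow> inv_into UNIV g \<in> G"
    using subgroup.m_inv_closed[OF assms] * m_inv_Aut by (metis subsetD)
qed

lemma subgroup_corneration_symmetries: "subgroup (corneration_symmetries M L) (Aut M)"
proof (rule group.subgroupI[OF group_Aut])
  have comp: "act_corner (g \<circ> h) = act_corner g \<circ> act_corner h" for g h :: "'f \<Rightarrow> 'f"
    by (auto simp: act_corner_def image_comp fun_eq_iff image_image)
  have id: "act_corner id = id" by (auto simp: act_corner_def fun_eq_iff)
  have "id \<in> symmetries M" by (simp add: symmetries_def permutes_id)
  then have "id \<in> corneration_symmetries M L" by (simp add: corneration_symmetries_def id)
  then show "corneration_symmetries M L \<noteq> {}" by blast
  show "corneration_symmetries M L \<subseteq> carrier (Aut M)"
    by (auto simp: corneration_symmetries_def Aut_def)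
  fix g assume g: "g \<in> corneration_symmetries M L"
  then have sym: "g \<in> symmetries M" and gL: "act_corner g ` L = L"
    by (auto simp: corneration_symmetries_def)
  have "inv_into UNIV g \<circ> g = id" using sym by (rule symmetries_inv_o)
  then have "act_corner (inv_into UNIV g) \<circ> act_corner g = id"
    using comp[of "inv_into UNIV g" g] id by metis
  then have "act_corner (inv_into UNIV g) ` act_corner g ` L = L"
    by (simp only: image_comp image_id id_apply)
  then show "inv\<^bsub>Aut M\<^esub> g \<in> corneration_symmetries M L"
    using sym gL by (simp add: m_inv_Aut corneration_symmetries_def symmetries_inv)
  fix h assume "h \<in> corneration_symmetries M L"
  then have h: "h \<in> symmetries M" "act_corner h ` L = L"
    by (auto simp: corneration_symmetries_def)
  have "act_corner (g \<circ> h) ` L = act_corner g ` act_corner h ` L"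
    by (simp only: comp image_comp)
  then show "g \<otimes>\<^bsub>Aut M\<^esub> h \<in> corneration_symmetries M L"
    using sym gL h by (simp add: corneration_symmetries_def Aut_def symmetries_comp)
qed

section \<open>Symmetries of the Petrie dual\<close>

lemma flags_petrie_dual [simp]: "flags (petrie_dual M) = flags M"
  by (simp add: petrie_dual_def)

text \<open>Composing \<open>r0 \<circ> r2\<close> with \<open>r2\<close> gives back
  \<open>r0\<close>, so commuting with the adjacencies of the dual means commuting with those of the
  map.\<close>

lemma symmetries_petrie_dual: "symmetries (petrie_dual M) = symmetries M"
proof -
  have "g (r0 M f) = r0 M (g f)"
    if "g permutes flags M" "f \<in> flags M"
      "\<forall>f \<in> flags M. g (r0 M (r2 M f)) = r0 M (r2 M (g f)) \<and> g (r2 M f) = r2 M (g f)" for g f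
    using that by (metis flag_simps(3,6))
  then show ?thesis by (auto simp: symmetries_def petrie_dual_def)
qed

lemma Aut_petrie_dual: "Aut (petrie_dual M) = Aut M"
  by (simp add: Aut_def symmetries_petrie_dual)


section \<open>From a symmetric corneration to a half-reflexible group\<close>

lemma symmetric_corneration_imp:
  assumes val: "has_valence M q" and j: "0 < j" "2 * j < q"
    and L: "j_corneration M j L" "symmetric_corneration M L"
  shows "odd j \<and> (\<exists>G. subgroup G (Aut M) \<and>
    (acts_half_reflexibly G M \<or> acts_half_reflexibly G (petrie_dual M)))"
proof -
  define A where "A = corneration_symmetries M L"
  define P where "P f \<longleftrightarrow> corner_at M j f \<in> L" for f
  have A_sym: "g \<in> symmetries M" if "g \<in> A" for g
    using that by (simp add: A_def corneration_symmetries_def)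
  have unique: "\<exists>!c. c \<in> L \<and> dart_in_corner (vertex_of M f, edge_of M f) c"
    if "f \<in> flags M" for f
    using L(1) that unfolding j_corneration_def corneration_def darts_eq by blast
  have P_reflect: "P (r2 M ((rot M ^^ j) f)) \<longleftrightarrow> P f" if "f \<in> flags M" for f
    using that by (simp add: P_def corner_at_reflect)
  \<comment> \<open>Every dart lies in a corner of \<open>L\<close>, so one of its two flags is
    black; the corner is unique, so they are not both black.\<close>
  have P_r2: "P (r2 M f) \<longleftrightarrow> \<not> P f" if f: "f \<in> flags M" for f
  proof
    assume r2: "P (r2 M f)"
    show "\<not> P f"
    proof
      assume "P f"
      let ?g = "(rot M ^^ j) f" and ?h = "(rot M ^^ j) (r2 M f)"
      have "corner_at M j f = corner_at M j (r2 M f)"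
      proof -
        have "dart_in_corner (vertex_of M f, edge_of M f) (corner_at M j f)"
          "dart_in_corner (vertex_of M f, edge_of M f) (corner_at M j (r2 M f))"
          using f by (simp_all add: dart_in_corner_def corner_at_def)
        then show ?thesis using unique[OF f] \<open>P f\<close> r2 unfolding P_def by blast
      qed
      then have "edge_of M ?g = edge_of M ?h"
        using f by (auto simp: corner_at_def doubleton_eq_iff)
      with f have "?h = ?g \<or> ?h = r2 M ?g" by (intro same_dart) auto
      then show False
      proof
        assume "?h = ?g"
        then have "r2 M f = f" using rot_inj[of "r2 M f" f] f by simp
        then show False using no_boundary f by blast
      next
        assume "?h = r2 M ?g"
        then have "(rot M ^^ j) ?h = r2 M f" using rot_reflect f by simp
        \<comment> \<open>The corner would join opposite edges at the vertex, and
          \<open>2 * j\<close> rotations would fix a flag. The strict bound \<open>2 * j < q\<close>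
          rules this out.\<close>
        then have "(rot M ^^ (2 * j)) (r2 M f) = r2 M f" by (simp add: funpow_add mult_2)
        then show False using valence_period(3)[OF val, of "r2 M f" "2 * j"] f j by simp
      qed
    qed
  next
    assume "\<not> P f"
    obtain c where c: "c \<in> L" "dart_in_corner (vertex_of M f, edge_of M f) c"
      using unique[OF f] by blast
    obtain h where h: "h \<in> flags M" "c = corner_at M j h"
      using j_corner_cases[OF val, of j c] c(1) L(1) by (auto simp: j_corneration_def)
    \<comment> \<open>The flags \<open>h\<close> and \<open>?k\<close> both give \<open>c\<close>,
      one at each of its darts, so \<open>f\<close> is one of them or the mirror image of
      one.\<close>
    let ?k = "r2 M ((rot M ^^ j) h)"
    have "P h" "P ?k" using c(1) h P_reflect by (auto simp: P_def)
    have "vertex_of M h = vertex_of M f"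
      "edge_of M h = edge_of M f \<or> edge_of M ?k = edge_of M f"
      using c(2) h by (auto simp: dart_in_corner_def corner_at_def)
    then have "f = h \<or> f = r2 M h \<or> f = ?k \<or> f = r2 M ?k"
      using same_dart[of h f] same_dart[of ?k f] f h(1) by auto
    with \<open>P h\<close> \<open>P ?k\<close> \<open>\<not> P f\<close> h(1) show "P (r2 M f)"
      by (metis flag_simps(6) rot_closed)
  qed
  have P_mono: "P (g f)" if "g \<in> A" "f \<in> flags M" "P f" for g f
  proof -
    have "act_corner g (corner_at M j f) \<in> L"
      using that by (auto simp: A_def P_def corneration_symmetries_def)
    then show ?thesis using that A_sym by (simp add: P_def act_corner_corner_at)
  qed
  \<comment> \<open>For the converse, if \<open>f\<close> is white then \<open>r2 M f\<close> is
    black, hence so is its image \<open>r2 M (g f)\<close>.\<close>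
  have P_inv: "P (g f) \<longleftrightarrow> P f" if "g \<in> A" "f \<in> flags M" for g f
    using P_mono[OF that] P_mono[OF that(1), of "r2 M f"] P_r2[OF that(2)] P_r2[of "g f"]
      symmetry_simps[OF A_sym[OF that(1)] that(2)] that(2) by auto
  \<comment> \<open>Transitivity on darts yields a \<open>g\<close> taking \<open>f\<close> to
    \<open>h\<close> or to \<open>r2 M h\<close>; as \<open>g\<close> keeps colours, only
    \<open>h\<close> is possible.\<close>
  have trans: "\<exists>g \<in> A. g f = h" if f: "f \<in> flags M" "h \<in> flags M" "P f \<longleftrightarrow> P h" for f h
  proof -
    have "(vertex_of M f, edge_of M f) \<in> darts M" "(vertex_of M h, edge_of M h) \<in> darts M"
      using f by (auto simp: darts_eq)
    then obtain g where g: "g \<in> A"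
      "act_dart g (vertex_of M f, edge_of M f) = (vertex_of M h, edge_of M h)"
      using L(2) unfolding symmetric_corneration_def A_def by metis
    then have "vertex_of M (g f) = vertex_of M h" "edge_of M (g f) = edge_of M h"
      using f A_sym by (auto simp: act_dart_def symmetry_vertex_of symmetry_edge_of)
    then have "g f = h \<or> g f = r2 M h"
      using same_dart[of h "g f"] f g A_sym symmetry_simps(1) by auto
    moreover have "g f \<noteq> r2 M h" using P_inv[of g f] P_r2[of h] f g by auto
    ultimately show ?thesis using g by blast
  qed
  \<comment> \<open>\<open>A\<close> is transitive on each colour class and commutes with
    \<open>r\<close>, so whether \<open>r\<close> keeps the colour is constant on a class. As
    \<open>r\<close> is an involution, it cannot keep one class and send the other into it.\<close>
  have dichotomy: "(\<forall>f \<in> flags M. P (r f) \<longleftrightarrow> P f) \<or> (\<forall>f \<in> flags M. P (r f) \<longleftrightarrow> \<not> P f)"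
    if r: "\<And>f. f \<in> flags M \<Longrightarrow> r f \<in> flags M \<and> r (r f) = f"
      "\<And>g f. \<lbrakk>g \<in> symmetries M; f \<in> flags M\<rbrakk> \<Longrightarrow> g (r f) = r (g f)" for r
  proof (rule disjCI)
    have orb: "P (r f) \<longleftrightarrow> P (r h)" if "f \<in> flags M" "h \<in> flags M" "P f \<longleftrightarrow> P h" for f h
      using trans[OF that] r A_sym P_inv that by metis
    assume "\<not> (\<forall>f \<in> flags M. P (r f) \<longleftrightarrow> \<not> P f)"
    then obtain f where f: "f \<in> flags M" "P (r f) \<longleftrightarrow> P f" by blast
    show "\<forall>h \<in> flags M. P (r h) \<longleftrightarrow> P h"
    proof
      fix h assume h: "h \<in> flags M"
      show "P (r h) \<longleftrightarrow> P h"
      proof (cases "P h \<longleftrightarrow> P f")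
        case True
        then show ?thesis using orb[OF h f(1)] f by blast
      next
        case False
        have "P (r h) \<noteq> P f"
          using orb[of "r h" f] r(1)[OF h] f False by auto
        with False show ?thesis by blast
      qed
    qed
  qed
  have P_rot_j: "P ((rot M ^^ j) f) \<longleftrightarrow> \<not> P f" if "f \<in> flags M" for f
    using P_reflect[OF that] P_r2[OF rot_closed[OF that]] by blast
  obtain f0 where f0: "f0 \<in> flags M" using flags_nonempty by blast
  \<comment> \<open>If \<open>r1\<close> swapped the colours, then the rotation and all its powers
    would keep them, against \<open>P_rot_j\<close>.\<close>
  have P_r1: "\<forall>f \<in> flags M. P (r1 M f) \<longleftrightarrow> P f"
  proof (rule ccontr)
    assume "\<not> (\<forall>f \<in> flags M. P (r1 M f) \<longleftrightarrow> P f)"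
    then have "\<forall>f \<in> flags M. P (r1 M f) \<longleftrightarrow> \<not> P f"
      using dichotomy[of "r1 M"] by (auto simp: symmetry_simps)
    then have rot: "P (rot M f) \<longleftrightarrow> P f" if "f \<in> flags M" for f
      using that P_r2 by (simp add: rot_apply)
    have "P ((rot M ^^ i) f0) \<longleftrightarrow> P f0" for i
      by (induction i) (use rot f0 in auto)
    then show False using P_rot_j f0 by blast
  qed
  \<comment> \<open>A single rotation swaps the colours, so they alternate around the vertex;
    comparison with \<open>P_rot_j\<close> gives the parity of \<open>j\<close>.\<close>
  have "P ((rot M ^^ i) f0) \<longleftrightarrow> (P f0 \<longleftrightarrow> even i)" for i
  proof (induction i)
    case (Suc i)
    have "P (rot M ((rot M ^^ i) f0)) \<longleftrightarrow> \<not> P ((rot M ^^ i) f0)"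
      using f0 P_r1 P_r2 rot_closed[OF f0] by (simp add: rot_apply)
    then show ?case using Suc by auto
  qed simp
  then have "odd j" using P_rot_j[OF f0] by blast
  have sub: "subgroup A (Aut M)"
    unfolding A_def by (rule subgroup_corneration_symmetries)
  have not_trans: "\<not> transitive_on A (flags M)"
  proof
    assume "transitive_on A (flags M)"
    then obtain g where "g \<in> A" "g f0 = r2 M f0"
      using f0 flag_simps(3)[OF f0] unfolding transitive_on_def by blast
    then show False using P_inv[of g f0] P_r2 f0 by auto
  qed
  \<comment> \<open>With \<open>r\<close> left open, one argument covers the faces of the map
    (\<open>r0 M\<close>) and those of the Petrie dual (\<open>r0 M \<circ> r2 M\<close>): both
    kinds of step keep the colour, so the face is monochromatic.\<close>
  have faces_trans: "transitive_on (setwise_stabilizer A F) F"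
    if F: "F = orbit_of {r, r1 M} f" and f: "f \<in> flags M"
      and r: "\<And>f. f \<in> flags M \<Longrightarrow> r f \<in> flags M \<and> r (r f) = f \<and> (P (r f) \<longleftrightarrow> P f)"
      "\<And>g f. \<lbrakk>g \<in> symmetries M; f \<in> flags M\<rbrakk> \<Longrightarrow> g (r f) = r (g f)" for F f r
    unfolding F
  proof (rule transitive_on_stabilizer_orbit_of[OF f])
    have preserve: "s z \<in> flags M \<and> s (s z) = z \<and> (P (s z) \<longleftrightarrow> P z)"
      if s: "s \<in> {r, r1 M}" and z: "z \<in> flags M" for s z
    proof (cases "s = r1 M")
      case True
      then show ?thesis using z P_r1 by simp
    next
      case False
      with s have "s = r" by blast
      then show ?thesis using r(1)[OF z] by (simp only:)
    qed
    show "s z \<in> flags M \<and> s (s z) = z" if "s \<in> {r, r1 M}" "z \<in> flags M" for s z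
      using preserve[OF that] by blast
    show "g (s z) = s (g z)" if g: "g \<in> A" and s: "s \<in> {r, r1 M}" and z: "z \<in> flags M" for g s z
    proof (cases "s = r1 M")
      case True
      then show ?thesis using symmetry_simps(3)[OF A_sym[OF g] z] by (simp only:)
    next
      case False
      with s have "s = r" by blast
      then show ?thesis using r(2)[OF A_sym[OF g] z] by (simp only:)
    qed
    have color: "z \<in> flags M \<and> (P z \<longleftrightarrow> P f)" if "z \<in> orbit_of {r, r1 M} f" for z
      using that
    proof (induction rule: orbit_of_induct)
      case base
      show ?case using f by blast
    next
      case (step z s)
      then show ?case using preserve[of s z] by blast
    qed
    show "\<exists>g \<in> A. g x = y" if "x \<in> orbit_of {r, r1 M} f" "y \<in> orbit_of {r, r1 M} f" for x y
      using trans[of x y] color[OF that(1)] color[OF that(2)] by blast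
  qed
  have "acts_half_reflexibly A M \<or> acts_half_reflexibly A (petrie_dual M)"
    using dichotomy[of "r0 M"]
  proof (rule disjE)
    assume "\<forall>f \<in> flags M. P (r0 M f) \<longleftrightarrow> P f"
    then have "acts_half_reflexibly A M"
      unfolding acts_half_reflexibly_def
      using sub not_trans
      by (auto simp: faces_def face_of_def symmetry_simps intro!: faces_trans)
    then show ?thesis ..
  next
    assume r0: "\<forall>f \<in> flags M. P (r0 M f) \<longleftrightarrow> \<not> P f"
    \<comment> \<open>Both factors swap the colours, so their composite keeps them; it is an
      involution because they commute.\<close>
    have "(r0 M \<circ> r2 M) f \<in> flags M \<and> (r0 M \<circ> r2 M) ((r0 M \<circ> r2 M) f) = f
      \<and> (P ((r0 M \<circ> r2 M) f) \<longleftrightarrow> P f)" if "f \<in> flags M" for f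
      using that r0 P_r2 r0_r2_commute by auto
    moreover have "g ((r0 M \<circ> r2 M) f) = (r0 M \<circ> r2 M) (g f)"
      if "g \<in> symmetries M" "f \<in> flags M" for g f
      using that by (simp add: symmetry_simps)
    ultimately have "transitive_on (setwise_stabilizer A F) F"
      if "F = orbit_of {r0 M \<circ> r2 M, r1 M} f" "f \<in> flags M" for F f
      by (rule faces_trans[OF that])
    moreover have "face_of (petrie_dual M) f = orbit_of {r0 M \<circ> r2 M, r1 M} f" for f
      by (simp add: face_of_def petrie_dual_def)
    ultimately have "acts_half_reflexibly A (petrie_dual M)"
      unfolding acts_half_reflexibly_def Aut_petrie_dual faces_def flags_petrie_dual
      using sub not_trans by blast
    then show ?thesis ..
  qed (auto simp: symmetry_simps)
  with sub \<open>odd j\<close> show ?thesis by blast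
qed

section \<open>From a half-reflexible group to a symmetric corneration\<close>

text \<open>The two choices of \<open>r\<close> are the face step of the map and that of its Petrie
  dual. Half-reflexibility enters through intransitivity on flags and the
  \<open>G\<close>-equivalence of each flag with its neighbours under \<open>r\<close> and
  \<open>r1\<close>.\<close>

lemma symmetric_corneration_if:
  assumes val: "has_valence M q" and j: "odd j" "j < q"
    and G: "subgroup G (Aut M)" "\<not> transitive_on G (flags M)"
    and r: "r = r0 M \<or> r = r0 M \<circ> r2 M"
    and faces: "\<And>f. f \<in> flags M \<Longrightarrow> (\<exists>g \<in> G. g f = r f) \<and> (\<exists>g \<in> G. g f = r1 M f)"
  shows "\<exists>L. j_corneration M j L \<and> symmetric_corneration M L"
proof -
  note G_simps = subgroup_symmetries[OF G(1)]
  have sym: "g \<in> symmetries M" if "g \<in> G" for g using that G_simps(1) by blast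
  have inv: "inv_into UNIV g (g f) = f" "g (inv_into UNIV g f) = f" if "g \<in> G" for g f
    using sym[OF that] by (auto simp: symmetries_def permutes_inverses)
  obtain f0 where f0: "f0 \<in> flags M" using flags_nonempty by blast
  \<comment> \<open>The black flags are the \<open>G\<close>-orbit of an arbitrary base
    flag.\<close>
  define P where "P f \<longleftrightarrow> (\<exists>g \<in> G. g f0 = f)" for f
  have P_f0: "P f0" unfolding P_def using G_simps(2) by (intro bexI[of _ id]) simp_all
  have P_mono: "P (g f)" if "P f" "g \<in> G" for g f
    using that G_simps(3) unfolding P_def by (metis o_apply)
  have P_inv: "P (g f) \<longleftrightarrow> P f" if "g \<in> G" for g f
    using P_mono[of f g] P_mono[of "g f" "inv_into UNIV g"] G_simps(4) inv that by metis
  have trans: "\<exists>g \<in> G. g f = h" if "P f" "P h" for f h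
  proof -
    obtain a b where ab: "a \<in> G" "b \<in> G" "a f0 = f" "b f0 = h" using \<open>P f\<close> \<open>P h\<close> P_def by blast
    then have "(b \<circ> inv_into UNIV a) f = h" "b \<circ> inv_into UNIV a \<in> G" using inv G_simps by auto
    then show ?thesis by blast
  qed
  have P_r1: "P (r1 M f) \<longleftrightarrow> P f" and P_r: "P (r f) \<longleftrightarrow> P f" if "f \<in> flags M" for f
    using faces[OF that] P_inv by metis+
  \<comment> \<open>The element of \<open>G\<close> taking \<open>f\<close> to \<open>r1 M f\<close>
    commutes with \<open>r2\<close>, so it also takes \<open>r2 M f\<close> to
    \<open>r2 M (r1 M f)\<close>.\<close>
  have P_r2_r1: "P (r2 M (r1 M f)) \<longleftrightarrow> P (r2 M f)" if f: "f \<in> flags M" for f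
  proof -
    obtain g where "g \<in> G" "g f = r1 M f" using faces[OF f] by blast
    then have "r2 M (r1 M f) = g (r2 M f)" using sym symmetry_simps(4) f by metis
    then show ?thesis using P_inv \<open>g \<in> G\<close> by metis
  qed
  \<comment> \<open>The flags \<open>f\<close> with \<open>f\<close> or \<open>r2 M f\<close> black
    include \<open>f0\<close> and are closed under all three adjacencies, so connectedness makes
    them all the flags.\<close>
  have cover: "P f \<or> P (r2 M f)" if "f \<in> flags M" for f
  proof -
    have "f \<in> flags M \<and> (P f \<or> P (r2 M f))" if "f \<in> orbit_of {r0 M, r1 M, r2 M} f0"
      using that
    proof (induction rule: orbit_of_induct)
      case base
      show ?case using f0 P_f0 by blast
    next
      case (step x s)
      then have x: "x \<in> flags M" by blast
      from step.hyps(2) consider "s = r0 M" | "s = r1 M" | "s = r2 M" by blast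
      then show ?case
      proof cases
        case 1
        \<comment> \<open>Using both \<open>x\<close> and \<open>r2 M x\<close> settles both forms
          of \<open>r\<close>: in the Petrie case \<open>r\<close> takes \<open>r2 M x\<close> to
          \<open>r0 M x\<close> and \<open>x\<close> to \<open>r2 M (r0 M x)\<close>.\<close>
        have "P (r x) \<longleftrightarrow> P x" "P (r (r2 M x)) \<longleftrightarrow> P (r2 M x)" using P_r x by auto
        then show ?thesis using r step x 1 r0_r2_commute[OF x] by auto
      next
        case 2
        then show ?thesis using step x P_r1 P_r2_r1 by auto
      next
        case 3
        then show ?thesis using step x by auto
      qed
    qed
    then show ?thesis using connected[OF f0 that] by blast
  qed
  \<comment> \<open>If one black flag had a black mirror image, then so would every black flag by
    moving it with \<open>G\<close>; with \<open>cover\<close> all flags would be black and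
    \<open>G\<close> transitive.\<close>
  have not_both: "\<not> (P f \<and> P (r2 M f))" if f: "f \<in> flags M" for f
  proof
    assume both: "P f \<and> P (r2 M f)"
    have "P h" if h: "h \<in> flags M" for h
    proof (rule ccontr)
      assume "\<not> P h"
      then have "P (r2 M h)" using cover h by blast
      then obtain g where g: "g \<in> G" "g f = r2 M h" using trans both by blast
      then have "g (r2 M f) = h" using sym symmetry_simps f h flag_simps(6) by metis
      then have "P h" using P_inv[OF g(1)] both by metis
      with \<open>\<not> P h\<close> show False ..
    qed
    then show False using G(2) trans by (auto simp: transitive_on_def)
  qed
  have P_r2: "P (r2 M f) \<longleftrightarrow> \<not> P f" if "f \<in> flags M" for f
    using cover not_both that by blast
  have P_rot: "P ((rot M ^^ i) f) \<longleftrightarrow> (P f \<longleftrightarrow> even i)" if "f \<in> flags M" for f i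
  proof (induction i)
    case (Suc i)
    have "P (rot M ((rot M ^^ i) f)) \<longleftrightarrow> \<not> P ((rot M ^^ i) f)"
      using P_r1 P_r2 rot_closed[OF that] by (simp add: rot_apply)
    then show ?case using Suc by auto
  qed simp
  define L where "L = corner_at M j ` {f \<in> flags M. P f}"
  have L_corner: "j_corner M j c" if "c \<in> L" for c
    using that j_corner_corner_at[OF val] j by (auto simp: L_def odd_pos)
  have black_flag: "\<exists>f \<in> flags M. P f \<and> d = (vertex_of M f, edge_of M f)"
    if d: "d \<in> darts M" for d
  proof -
    obtain h where h: "h \<in> flags M" "d = (vertex_of M h, edge_of M h)"
      using d unfolding darts_eq by blast
    then have "r2 M h \<in> flags M" "d = (vertex_of M (r2 M h), edge_of M (r2 M h))"
      by auto
    then show ?thesis using cover[of h] h by blast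
  qed
  have "\<exists>!c. c \<in> L \<and> dart_in_corner d c" if d: "d \<in> darts M" for d
  proof -
    obtain f where f: "f \<in> flags M" "P f" "d = (vertex_of M f, edge_of M f)"
      using black_flag[OF d] by blast
    show ?thesis
    proof (rule ex1I[of _ "corner_at M j f"])
      show "corner_at M j f \<in> L \<and> dart_in_corner d (corner_at M j f)"
        using f by (auto simp: L_def dart_in_corner_def corner_at_def)
    next
      fix c assume c: "c \<in> L \<and> dart_in_corner d c"
      then obtain h where h: "h \<in> flags M" "P h" "c = corner_at M j h" by (auto simp: L_def)
      let ?k = "r2 M ((rot M ^^ j) h)"
      \<comment> \<open>The oddness of \<open>j\<close> enters here: \<open>j\<close> rotations swap
        the colour and \<open>r2\<close> swaps it back, so both flags giving the corner are
        black.\<close>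
      have k: "?k \<in> flags M" "P ?k" "c = corner_at M j ?k"
        using h P_rot P_r2 j by (auto simp: corner_at_reflect)
      have "vertex_of M h = vertex_of M f"
        "edge_of M h = edge_of M f \<or> edge_of M ?k = edge_of M f"
        using c f h by (auto simp: dart_in_corner_def corner_at_def)
      then have "f = h \<or> f = r2 M h \<or> f = ?k \<or> f = r2 M ?k"
        using same_dart[of h f] same_dart[of ?k f] f h k by auto
      then have "f = h \<or> f = ?k" using P_r2 f h k by blast
      with h k show "c = corner_at M j f" by auto
    qed
  qed
  then have corn: "corneration M L"
    using L_corner by (auto simp: corneration_def j_corner_def)
  have G_L: "act_corner g ` L = L" if g: "g \<in> G" for g
  proof -
    have sub: "act_corner g c \<in> L" if "g \<in> G" "c \<in> L" for g c
    proof -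
      obtain f where f: "f \<in> flags M" "P f" "c = corner_at M j f"
        using \<open>c \<in> L\<close> by (auto simp: L_def)
      then have "act_corner g c = corner_at M j (g f)" "g f \<in> flags M" "P (g f)"
        using that(1) sym P_inv act_corner_corner_at symmetry_simps(1) by auto
      then show ?thesis by (auto simp: L_def)
    qed
    have "c \<in> act_corner g ` L" if "c \<in> L" for c
    proof (rule image_eqI)
      show "act_corner (inv_into UNIV g) c \<in> L" using sub G_simps(4) g that by blast
      show "c = act_corner g (act_corner (inv_into UNIV g) c)"
        using inv(2)[OF g] by (simp add: act_corner_def image_image prod_eq_iff)
    qed
    then show ?thesis using sub g by blast
  qed
  have "\<exists>g \<in> corneration_symmetries M L. act_dart g d = d'"
    if d: "d \<in> darts M" "d' \<in> darts M" for d d'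
  proof -
    obtain f where f: "f \<in> flags M" "P f" "d = (vertex_of M f, edge_of M f)"
      using black_flag[OF d(1)] by blast
    obtain h where h: "h \<in> flags M" "P h" "d' = (vertex_of M h, edge_of M h)"
      using black_flag[OF d(2)] by blast
    obtain g where g: "g \<in> G" "g f = h" using trans f h by blast
    then have "act_dart g d = d'"
      using f h sym by (simp add: act_dart_def symmetry_vertex_of symmetry_edge_of)
    moreover have "g \<in> corneration_symmetries M L"
      using g sym G_L by (simp add: corneration_symmetries_def)
    ultimately show ?thesis by blast
  qed
  with corn L_corner show ?thesis
    unfolding j_corneration_def symmetric_corneration_def by blast
qed

text \<open>A flag shares its face with its images under \<open>r0\<close> and \<open>r1\<close>.
  The system \<open>N\<close> is arbitrary so that it can also be the Petrie dual.\<close>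

lemma half_reflexible_face_steps:
  assumes "acts_half_reflexibly G N" "f \<in> flags N"
  shows "(\<exists>g \<in> G. g f = r0 N f) \<and> (\<exists>g \<in> G. g f = r1 N f)"
proof -
  have "transitive_on (setwise_stabilizer G (face_of N f)) (face_of N f)"
    using assms by (auto simp: acts_half_reflexibly_def faces_def)
  moreover have "f \<in> face_of N f" "r0 N f \<in> face_of N f" "r1 N f \<in> face_of N f"
    by (auto simp: face_of_def orbit_of_refl orbit_of_step)
  ultimately show ?thesis unfolding transitive_on_def setwise_stabilizer_def by blast
qed

end

theorem theorem9p1:
  fixes M :: "'f flag_system" and q j :: nat
  assumes "surface_map M" and "has_valence M q"
    and "0 < j" and "real j < real q / 2"
  shows "(\<exists>L. j_corneration M j L \<and> symmetric_corneration M L) \<longleftrightarrow>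
    odd j \<and> (\<exists>G. subgroup G (Aut M) \<and>
      (acts_half_reflexibly G M \<or> acts_half_reflexibly G (petrie_dual M)))"
proof -
  interpret surface_map M by (rule assms(1))
  have j: "2 * j < q" "j < q" using assms(4) by linarith+
  show ?thesis
  proof
    assume "\<exists>L. j_corneration M j L \<and> symmetric_corneration M L"
    then show "odd j \<and> (\<exists>G. subgroup G (Aut M) \<and>
        (acts_half_reflexibly G M \<or> acts_half_reflexibly G (petrie_dual M)))"
      using symmetric_corneration_imp[OF assms(2,3) j(1)] by blast
  next
    assume "odd j \<and> (\<exists>G. subgroup G (Aut M) \<and>
      (acts_half_reflexibly G M \<or> acts_half_reflexibly G (petrie_dual M)))"
    then obtain G where "odd j" "subgroup G (Aut M)"
      and "acts_half_reflexibly G M \<or> acts_half_reflexibly G (petrie_dual M)" by blast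
    from this(3) show "\<exists>L. j_corneration M j L \<and> symmetric_corneration M L"
    proof
      assume G: "acts_half_reflexibly G M"
      show ?thesis
      proof (rule symmetric_corneration_if[OF assms(2) \<open>odd j\<close> j(2) \<open>subgroup G (Aut M)\<close>])
        show "\<not> transitive_on G (flags M)" using G by (simp add: acts_half_reflexibly_def)
        show "r0 M = r0 M \<or> r0 M = r0 M \<circ> r2 M" by simp
      qed (rule half_reflexible_face_steps[OF G])
    next
      assume G: "acts_half_reflexibly G (petrie_dual M)"
      show ?thesis
      proof (rule symmetric_corneration_if[OF assms(2) \<open>odd j\<close> j(2) \<open>subgroup G (Aut M)\<close>])
        show "\<not> transitive_on G (flags M)" using G by (simp add: acts_half_reflexibly_def)
        show "r0 (petrie_dual M) = r0 M \<or> r0 (petrie_dual M) = r0 M \<circ> r2 M"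
          by (simp add: petrie_dual_def)
        fix f assume "f \<in> flags M"
        then show "(\<exists>g \<in> G. g f = r0 (petrie_dual M) f) \<and> (\<exists>g \<in> G. g f = r1 M f)"
          using half_reflexible_face_steps[OF G, of f] by (simp add: petrie_dual_def)
      qed
    qed
  qed
qed

end
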